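(* As $n\to\infty$, $$P(\widehat I_{0,n}\ne I^* )=O(1/\sqrt n),$$ where: 1. if $\rho_k=0$, then $I^*=I_0$; 2. if $\rho_k>0$, then $I^*=\emptyset$; 3. if $\rho_k<0$, then $I^*=I_-\cup I_0$ with $I_-=\bigcup_{h\in\mathcal H_k^-}I_h$ and $\mathcal H_k^-=\{h\in[\rho_k,0):\ \exists\, j\in\mathcal S_k\text{ such that }\nabla^kp(j)=h\}$.
   Context: Let $k\ge1$ be an integer, let $m\le M-k$ be integers, $\mathcal S=\{m,\dots,M\}$, $\mathcal S_k=\{m,\dots,M-k\}$, and let $p$ be a p.m.f. on $\mathbb Z$ with support $\mathcal S$ (i.e. $p(j)>0$ iff $j\in\mathcal S$). For a real function $q$ of an integer variable, $\nabla^kq(j)=(-1)^k\Delta^kq(j)$, where $\Delta^0q(j)=q(j)$, $\Delta^1q(j)=q(j+1)-q(j)$, $\Delta^rq(j)=\Delta^1[\Delta^{r-1}q](j)$ for $r\ge2$. The notation $\nabla^k\mathbf 1_{\{X=j\}}$ means $\nabla^k$ applied to $j\mapsto\mathbf 1_{\{X=j\}}$. Put $\rho_k=\min_{j\in\mathcal S_k}\nabla^kp(j)$ and $I_h=\{j\in\mathcal S_k:\nabla^kp(j)=h\}$ for $h\in\mathbb R$. Let $X_1,X_2,\dots$ be i.i.d. with p.m.f. $p$, $\widehat p_n(j)=\frac1n\sum_{i=1}^n\mathbf 1_{\{X_i=j\}}$, $X_{(1)}$ and $X_{(n)}$ the minimum and maximum of $X_1,\dots,X_n$, and $\widehat{\mathcal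 S}_{k,n}=\{X_{(1)},\dots,X_{(n)}-k\}$ (all integers between the endpoints, possibly empty). Let $\widehat\sigma_{j,n}^2=\frac1n\sum_{i=1}^n(\nabla^k\mathbf 1_{\{X_i=j\}})^2-(\nabla^k\widehat p_n(j))^2$ be the empirical variance of $\nabla^k\mathbf 1_{\{X_1=j\}}$, and let $z_\beta$ be the $\beta$-quantile of the standard Gaussian. For $n\ge2$ define $$\widehat I_{0,n}=\Big\{j\in\widehat{\mathcal S}_{k,n}:\ \frac{\sqrt n\,\nabla^k\widehat p_n(j)}{\widehat\sigma_{j,n}}\le z_{1-1/n}\Big\},$$ where, if $\widehat\sigma_{j,n}=0$, the inequality is read as $\sqrt n\,\nabla^k\widehat p_n(j)\le z_{1-1/n}\widehat\sigma_{j,n}$. *)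

theory Defs
  imports "HOL-Probability.Probability" "HOL-Library.Landau_Symbols"
begin

primrec fdiff :: "nat \<Rightarrow> (int \<Rightarrow> real) \<Rightarrow> int \<Rightarrow> real" where
  "fdiff 0 q = q"
| "fdiff (Suc r) q = (\<lambda>j. fdiff r q (j + 1) - fdiff r q j)"

definition nabla :: "nat \<Rightarrow> (int \<Rightarrow> real) \<Rightarrow> int \<Rightarrow> real" where
  "nabla k q j = (-1) ^ k * fdiff k q j"

definition S_k :: "nat \<Rightarrow> int \<Rightarrow> int \<Rightarrow> int set" where
  "S_k k m M = {m..M - int k}"

definition rho :: "nat \<Rightarrow> int \<Rightarrow> int \<Rightarrow> int pmf \<Rightarrow> real" where
  "rho k m M p = Min (nabla k (pmf p) ` S_k k m M)"

definition I_level :: "nat \<Rightarrow> int \<Rightarrow> int \<Rightarrow> int pmf \<Rightarrow> real \<Rightarrow> int set" where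
  "I_level k m M p h = {j \<in> S_k k m M. nabla k (pmf p) j = h}"

definition H_neg :: "nat \<Rightarrow> int \<Rightarrow> int \<Rightarrow> int pmf \<Rightarrow> real set" where
  "H_neg k m M p = {h \<in> {rho k m M p..<0}. \<exists>j\<in>S_k k m M. nabla k (pmf p) j = h}"

definition I_neg :: "nat \<Rightarrow> int \<Rightarrow> int \<Rightarrow> int pmf \<Rightarrow> int set" where
  "I_neg k m M p = (\<Union>h\<in>H_neg k m M p. I_level k m M p h)"

text \<open>The estimators below are deterministic functions of a realisation \<open>x\<close> of the
  sequence of observations, of which only \<open>x 1, \<dots>, x n\<close> are used; they are meant for
  \<open>n \<ge> 1\<close> (\<open>n \<ge> 2\<close> for \<open>I0_hat\<close>).\<close>

definition p_hat :: "nat \<Rightarrow> (nat \<Rightarrow> int) \<Rightarrow> int \<Rightarrow> real" where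
  "p_hat n x j = 1 / real n * (\<Sum>i=1..n. of_bool (x i = j))"

definition S_hat :: "nat \<Rightarrow> nat \<Rightarrow> (nat \<Rightarrow> int) \<Rightarrow> int set" where
  "S_hat k n x = {Min (x ` {1..n})..Max (x ` {1..n}) - int k}"

definition var_hat :: "nat \<Rightarrow> nat \<Rightarrow> (nat \<Rightarrow> int) \<Rightarrow> int \<Rightarrow> real" where
  "var_hat k n x j =
     1 / real n * (\<Sum>i=1..n. (nabla k (\<lambda>l. of_bool (x i = l)) j)\<^sup>2) - (nabla k (p_hat n x) j)\<^sup>2"

definition sigma_hat :: "nat \<Rightarrow> nat \<Rightarrow> (nat \<Rightarrow> int) \<Rightarrow> int \<Rightarrow> real" where
  "sigma_hat k n x j = sqrt (var_hat k n x j)"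

text \<open>The quantile is the generalised inverse of the distribution function; it is meant for
  \<open>0 < \<beta> < 1\<close>, where the infimum is over a nonempty set bounded below.\<close>

definition std_normal_quantile :: "real \<Rightarrow> real" where
  "std_normal_quantile \<beta> = Inf {t. \<beta> \<le> cdf std_normal_distribution t}"

definition I0_hat :: "nat \<Rightarrow> nat \<Rightarrow> (nat \<Rightarrow> int) \<Rightarrow> int set" where
  "I0_hat k n x = {j \<in> S_hat k n x.
     if sigma_hat k n x j = 0
     then sqrt (real n) * nabla k (p_hat n x) j
            \<le> std_normal_quantile (1 - 1 / real n) * sigma_hat k n x j
     else sqrt (real n) * nabla k (p_hat n x) j / sigma_hat k n x j
            \<le> std_normal_quantile (1 - 1 / real n)}"

end

theory Submission
  imports Defs "HOL-Real_Asymp.Real_Asymp"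
begin

text \<open>
  In all three cases the target set is \<open>{j \<in> S_k. \<nabla>\<^sup>k p(j) \<le> 0}\<close>, so it suffices to control each
  of the finitely many tests separately. Hoeffding's inequality settles the tests with
  \<open>\<nabla>\<^sup>k p(j) \<noteq> 0\<close> and the event that the sample attains both ends of the support. If
  \<open>\<nabla>\<^sup>k p(j) = 0\<close>, the test statistic is a studentised mean of centred bounded variables. No
  Berry-Esseen bound is needed: the quantile \<open>z\<^bsub>1-1/n\<^esub>\<close> behaves like \<open>sqrt (2 ln n)\<close>, so it
  eventually exceeds \<open>t = sqrt (4/3 ln n)\<close>, and a Chernoff bound with the sharp variance constant,
  evaluated at \<open>15/16 t\<close>, already gives \<open>exp (- 3/8 t\<^sup>2) = 1 / sqrt n\<close>.
\<close>

section \<open>Finite differences\<close>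

lemma fdiff_const_mult_sum:
  "fdiff k (\<lambda>l. c * (\<Sum>i\<in>A. q i l)) j = c * (\<Sum>i\<in>A. fdiff k (q i) j)"
  by (induction k arbitrary: j) (simp_all add: sum_subtractf right_diff_distrib)

lemma nabla_p_hat:
  "nabla k (p_hat n x) j = (\<Sum>i=1..n. nabla k (\<lambda>l. of_bool (x i = l)) j) / real n"
proof -
  have "p_hat n x = (\<lambda>l. 1 / real n * (\<Sum>i=1..n. of_bool (x i = l)))"
    by (simp add: p_hat_def fun_eq_iff)
  then show ?thesis
    by (simp only: nabla_def fdiff_const_mult_sum) (simp add: sum_distrib_left sum_divide_distrib)
qed

text \<open>Each difference at most doubles a uniform bound.\<close>

lemma abs_fdiff_le:
  assumes "\<And>l. \<bar>q l\<bar> \<le> B"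
  shows "\<bar>fdiff k q j\<bar> \<le> 2 ^ k * B"
proof (induction k arbitrary: j)
  case (Suc k)
  show ?case
    using Suc[of j] Suc[of "j + 1"] by simp
qed (simp add: assms)

lemma abs_nabla_of_bool_le: "\<bar>nabla k (\<lambda>l. of_bool (Q l)) j\<bar> \<le> 2 ^ k"
  using abs_fdiff_le[of "\<lambda>l. of_bool (Q l)" 1 k j] by (simp add: nabla_def abs_mult power_abs)

text \<open>A difference of order \<open>k\<close> at \<open>j\<close> sees only the points
  \<open>j\<close> to \<open>j + k\<close>. With the next lemma, this serves to show that the tested
  variable is not almost surely zero.\<close>

lemma fdiff_of_bool_eq_0: "x > j + int k \<Longrightarrow> fdiff k (\<lambda>l. of_bool (x = l)) j = 0"
  by (induction k arbitrary: j) auto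

lemma fdiff_of_bool_top: "fdiff k (\<lambda>l. of_bool (j + int k = l)) j = 1"
proof (induction k arbitrary: j)
  case (Suc k)
  have "fdiff k (\<lambda>l. of_bool (j + 1 + int k = l)) (j + 1) = 1"
    by (rule Suc)
  moreover have "fdiff k (\<lambda>l. of_bool (j + 1 + int k = l)) j = 0"
    by (rule fdiff_of_bool_eq_0) simp
  ultimately show ?case
    by (simp add: algebra_simps)
qed simp

text \<open>Differencing commutes with the expectation, finite support giving integrability. Thus
  \<nabla> of the p.m.f. is the mean of a bounded function of one observation, and \<nabla> of the
  empirical p.m.f. is the matching sample mean.\<close>

lemma fdiff_pmf:
  assumes "finite (set_pmf p)"
  shows "fdiff k (pmf p) j = measure_pmf.expectation p (\<lambda>x. fdiff k (\<lambda>l. of_bool (x = l)) j)"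
proof (induction k arbitrary: j)
  case 0
  have "measure_pmf.expectation p (indicat_real {j}) = pmf p j"
    by (simp add: measure_pmf_single)
  also have "indicat_real {j} = (\<lambda>x. of_bool (x = j))"
    by (auto simp: indicator_def)
  finally show ?case
    by simp
next
  case (Suc k)
  then show ?case
    by (simp add: integrable_measure_pmf_finite[OF assms])
qed

lemma nabla_pmf:
  assumes "finite (set_pmf p)"
  shows "nabla k (pmf p) j = measure_pmf.expectation p (\<lambda>x. nabla k (\<lambda>l. of_bool (x = l)) j)"
  by (simp add: nabla_def fdiff_pmf[OF assms])

section \<open>Gaussian quantiles\<close>

text \<open>The density decreases on the positive half-line, so the mass of
  \<open>{t<..t+1}\<close>, an interval of length 1, is at least the density at its right end. The
  shift by 1 affects the exponent only in lower order.\<close>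

lemma cdf_std_normal_le:
  fixes t :: real
  assumes "0 \<le> t"
  shows "cdf std_normal_distribution t \<le> 1 - std_normal_density (t + 1)"
proof -
  interpret D: real_distribution std_normal_distribution
    by (rule real_dist_normal_dist)
  have "ennreal (std_normal_density (t + 1))
      = (\<integral>\<^sup>+x. ennreal (std_normal_density (t + 1)) * indicator {t<..t+1} x \<partial>lborel)"
    by (simp add: nn_integral_cmult)
  also have "\<dots> \<le> (\<integral>\<^sup>+x. ennreal (std_normal_density x) * indicator {t<..} x \<partial>lborel)"
  proof (rule nn_integral_mono)
    fix x :: real
    have "std_normal_density (t + 1) \<le> std_normal_density x" if "t < x" "x \<le> t + 1"
      using that assms by (auto simp: std_normal_density_def intro!: divide_right_mono power_mono)
    then show "ennreal (std_normal_density (t + 1)) * indicator {t<..t+1} x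
        \<le> ennreal (std_normal_density x) * indicator {t<..} x"
      by (auto simp: indicator_def intro!: ennreal_leI)
  qed
  also have "\<dots> = emeasure std_normal_distribution {t<..}"
    by (simp add: emeasure_density)
  finally have "std_normal_density (t + 1) \<le> measure std_normal_distribution {t<..}"
    by (simp add: D.emeasure_eq_measure)
  also have "{t<..} = space std_normal_distribution - {..t}"
    by auto
  also have "measure std_normal_distribution \<dots> = 1 - cdf std_normal_distribution t"
    unfolding cdf_def by (rule D.prob_compl) simp
  finally show ?thesis
    by simp
qed

text \<open>Markov's inequality for the fourth power, whose Gaussian mean is 3. A polynomial tail is
  enough, since the quantile only has to be of smaller order than \<open>sqrt n\<close>.\<close>

lemma cdf_std_normal_ge:
  fixes t :: real
  assumes "0 < t"
  shows "1 - 3 / t ^ 4 \<le> cdf std_normal_distribution t"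
proof -
  interpret D: real_distribution std_normal_distribution
    by (rule real_dist_normal_dist)
  have "1 - cdf std_normal_distribution t
      = measure std_normal_distribution (space std_normal_distribution - {..t})"
    unfolding cdf_def by (rule D.prob_compl[symmetric]) simp
  also have "\<dots> \<le> measure std_normal_distribution {x \<in> space std_normal_distribution. x ^ 4 \<ge> t ^ 4}"
    using assms by (intro D.finite_measure_mono) (auto intro!: power_mono)
  also have "\<dots> \<le> (LINT x|std_normal_distribution. x ^ 4) / t ^ 4"
    using std_normal_distribution_even_moments(2)[of 2] assms
    by (intro integral_Markov_inequality_measure[where A = "{}"]) auto
  also have "(LINT x|std_normal_distribution. x ^ 4) = 3"
    using std_normal_distribution_even_moments(1)[of 2] by (simp add: fact_numeral)
  finally show ?thesis
    by simp
qed

text \<open>By monotonicity of the distribution function, \<open>a\<close> is a lower bound of the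
  set whose infimum is taken; \<open>b\<close> is an element of it.\<close>

lemma std_normal_quantile_bounds:
  assumes "cdf std_normal_distribution a < \<beta>" and "\<beta> \<le> cdf std_normal_distribution b"
  shows "a \<le> std_normal_quantile \<beta>" and "std_normal_quantile \<beta> \<le> b"
proof -
  interpret D: real_distribution std_normal_distribution
    by (rule real_dist_normal_dist)
  have lower: "a \<le> t" if "\<beta> \<le> cdf std_normal_distribution t" for t
    using that assms(1) D.cdf_nondecreasing[of t a] by linarith
  then have "bdd_below {t. \<beta> \<le> cdf std_normal_distribution t}"
    by (auto intro!: bdd_belowI[of _ a])
  then show "std_normal_quantile \<beta> \<le> b"
    unfolding std_normal_quantile_def by (intro cInf_lower) (use assms(2) in auto)
  show "a \<le> std_normal_quantile \<beta>"
    unfolding std_normal_quantile_def by (rule cInf_greatest) (use assms(2) lower in auto)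
qed

lemma eventually_std_normal_quantile_bounds:
  "\<forall>\<^sub>F n in sequentially. sqrt (4 / 3 * ln (real n)) \<le> std_normal_quantile (1 - 1 / real n)
      \<and> std_normal_quantile (1 - 1 / real n) \<le> 2 * real n powr (1 / 4)"
proof -
  have "\<forall>\<^sub>F n::nat in sequentially. 1 / real n < std_normal_density (sqrt (4 / 3 * ln (real n)) + 1)"
  proof -
    define c where "c = 1 / sqrt (2 * pi)"
    have "c > 0"
      by (simp add: c_def)
    have "\<forall>\<^sub>F y in at_top. (sqrt (4 / 3 * y) + 1)\<^sup>2 / 2 - ln c < y"
      \<comment> \<open>With a = \<open>sqrt (4/3 * y)\<close>, the bound proved below gives (a +
        1)^2 / 2 \<le> 3/4 y + 9/2. After subtracting \<open>ln c\<close> this is below y exactly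
        when y > \<open>18 - 4 * ln c\<close>.\<close>
      using eventually_gt_at_top[of "max 0 (18 - 4 * ln c)"]
    proof eventually_elim
      case (elim y)
      have "(a + 1)\<^sup>2 \<le> 9 / 8 * a\<^sup>2 + 9" for a :: real
        using zero_le_power2[of "a - 8"] by (simp add: power2_eq_square algebra_simps)
      from this[of "sqrt (4 / 3 * y)"] show ?case
        using elim by simp
    qed
    moreover have "filterlim (\<lambda>n. ln (real n)) at_top sequentially"
      by real_asymp
    ultimately have "\<forall>\<^sub>F n in sequentially. (sqrt (4 / 3 * ln (real n)) + 1)\<^sup>2 / 2 - ln c < ln (real n)"
      by (rule eventually_compose_filterlim)
    with eventually_gt_at_top[of 0] show ?thesis
    proof eventually_elim
      case (elim n)
      have "1 / real n = exp (- ln (real n))"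
        using elim by (simp add: exp_minus inverse_eq_divide)
      also have "\<dots> < exp (ln c - (sqrt (4 / 3 * ln (real n)) + 1)\<^sup>2 / 2)"
        using elim by simp
      also have "\<dots> = std_normal_density (sqrt (4 / 3 * ln (real n)) + 1)"
        using \<open>c > 0\<close> by (simp add: std_normal_density_def c_def[symmetric] exp_diff exp_minus inverse_eq_divide)
      finally show ?case .
    qed
  qed
  with eventually_gt_at_top[of "1::nat"] show ?thesis
  proof eventually_elim
    case (elim n)
    have "cdf std_normal_distribution (sqrt (4 / 3 * ln (real n))) < 1 - 1 / real n"
      using cdf_std_normal_le[of "sqrt (4 / 3 * ln (real n))"] elim by simp
    \<comment> \<open>The fourth power of the argument is 16 n, so the Markov tail is 3 / (16 n),
      below 1 / n.\<close>
    moreover have "1 - 1 / real n \<le> cdf std_normal_distribution (2 * real n powr (1 / 4))"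
    proof -
      have "(real n powr (1 / 4)) ^ 4 = real n"
        using elim by (simp add: powr_powr flip: powr_realpow)
      then have "3 / (2 * real n powr (1 / 4)) ^ 4 = 3 / (16 * real n)"
        by (simp add: power_mult_distrib)
      also have "\<dots> \<le> 1 / real n"
        using elim by (simp add: field_simps)
      finally show ?thesis
        using cdf_std_normal_ge[of "2 * real n powr (1 / 4)"] elim by simp
    qed
    ultimately show ?case
      using std_normal_quantile_bounds by blast
  qed
qed

section \<open>Events of high probability\<close>

text \<open>The failures are only covered by events of probability \<open>O(r)\<close>.
  Measurability thus has to be checked for the basic events alone, not for statements derived from
  them.\<close>

definition (in prob_space) whp :: "(nat \<Rightarrow> real) \<Rightarrow> (nat \<Rightarrow> 'a \<Rightarrow> bool) \<Rightarrow> bool" where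
  "whp r Q \<longleftrightarrow> (\<exists>A. (\<forall>n. A n \<in> events) \<and> (\<lambda>n. prob (A n)) \<in> O(r)
     \<and> (\<forall>\<^sub>F n in sequentially. \<forall>\<omega>\<in>space M - A n. Q n \<omega>))"

context prob_space
begin

lemma whpI:
  assumes "\<And>n. {\<omega> \<in> space M. \<not> Q n \<omega>} \<in> events"
    and "(\<lambda>n. prob {\<omega> \<in> space M. \<not> Q n \<omega>}) \<in> O(r)"
  shows "whp r Q"
  unfolding whp_def using assms by (intro exI[of _ "\<lambda>n. {\<omega> \<in> space M. \<not> Q n \<omega>}"]) auto

lemma whp_eventually:
  assumes "\<forall>\<^sub>F n in sequentially. \<forall>\<omega>\<in>space M. Q n \<omega>"
  shows "whp r Q"
  unfolding whp_def using assms by (intro exI[of _ "\<lambda>n. {}"]) auto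

lemma whp_conj:
  assumes "whp r Q" "whp r R"
  shows "whp r (\<lambda>n \<omega>. Q n \<omega> \<and> R n \<omega>)"
proof -
  obtain A where A: "\<And>n. A n \<in> events" "(\<lambda>n. prob (A n)) \<in> O(r)"
    "\<forall>\<^sub>F n in sequentially. \<forall>\<omega>\<in>space M - A n. Q n \<omega>"
    using assms(1) unfolding whp_def by blast
  obtain B where B: "\<And>n. B n \<in> events" "(\<lambda>n. prob (B n)) \<in> O(r)"
    "\<forall>\<^sub>F n in sequentially. \<forall>\<omega>\<in>space M - B n. R n \<omega>"
    using assms(2) unfolding whp_def by blast
  have "(\<lambda>n. prob (A n \<union> B n)) \<in> O(\<lambda>n. prob (A n) + prob (B n))"
    using A(1) B(1) by (intro bigoI[of _ 1] always_eventually) (auto intro!: measure_Un_le)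
  also have "(\<lambda>n. prob (A n) + prob (B n)) \<in> O(r)"
    using A(2) B(2) by (rule sum_in_bigo)
  finally have "(\<lambda>n. prob (A n \<union> B n)) \<in> O(r)" .
  moreover have "\<forall>\<^sub>F n in sequentially. \<forall>\<omega>\<in>space M - (A n \<union> B n). Q n \<omega> \<and> R n \<omega>"
    using A(3) B(3) by eventually_elim auto
  ultimately show ?thesis
    unfolding whp_def using A(1) B(1) by (intro exI[of _ "\<lambda>n. A n \<union> B n"]) auto
qed

lemma whp_mono:
  assumes "whp r Q" and "\<forall>\<^sub>F n in sequentially. \<forall>\<omega>\<in>space M. Q n \<omega> \<longrightarrow> R n \<omega>"
  shows "whp r R"
proof -
  obtain A where A: "\<And>n. A n \<in> events" "(\<lambda>n. prob (A n)) \<in> O(r)"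
    "\<forall>\<^sub>F n in sequentially. \<forall>\<omega>\<in>space M - A n. Q n \<omega>"
    using assms(1) unfolding whp_def by blast
  have "\<forall>\<^sub>F n in sequentially. \<forall>\<omega>\<in>space M - A n. R n \<omega>"
    using A(3) assms(2) by eventually_elim auto
  with A(1,2) show ?thesis
    unfolding whp_def by blast
qed

lemma whp_ball:
  assumes "finite J" and "\<And>j. j \<in> J \<Longrightarrow> whp r (Q j)"
  shows "whp r (\<lambda>n \<omega>. \<forall>j\<in>J. Q j n \<omega>)"
  using assms
proof (induction J)
  case empty
  then show ?case
    by (simp add: whp_eventually)
next
  case (insert j J)
  then show ?case
    using whp_conj[of r "Q j" "\<lambda>n \<omega>. \<forall>j\<in>J. Q j n \<omega>"] by simp
qed

text \<open>Monotonicity of the measure asks measurability of the covering event only, not of the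
  failure set.\<close>

lemma prob_not_bigo_if_whp:
  assumes "whp r Q"
  shows "(\<lambda>n. prob {\<omega> \<in> space M. \<not> Q n \<omega>}) \<in> O(r)"
proof -
  obtain A where A: "\<And>n. A n \<in> events" "(\<lambda>n. prob (A n)) \<in> O(r)"
    "\<forall>\<^sub>F n in sequentially. \<forall>\<omega>\<in>space M - A n. Q n \<omega>"
    using assms unfolding whp_def by blast
  have "(\<lambda>n. prob {\<omega> \<in> space M. \<not> Q n \<omega>}) \<in> O(\<lambda>n. prob (A n))"
  proof (rule bigoI[of _ 1], use A(3) in eventually_elim)
    case (elim n)
    then have "{\<omega> \<in> space M. \<not> Q n \<omega>} \<subseteq> A n"
      by auto
    then show ?case
      using finite_measure_mono A(1) by simp
  qed
  with A(2) show ?thesis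
    by (rule landau_o.big_trans[rotated])
qed

end

section \<open>Means of bounded functions of an i.i.d. sample\<close>

text \<open>Taylor expansion with Lagrange remainder. The factor 1/2 of the square is kept, because
  the Chernoff exponent below needs it; the factor \<open>exp \<bar>x\<bar>\<close> tends to 1 for
  small arguments.\<close>

lemma exp_le_quadratic: "exp x \<le> 1 + x + x\<^sup>2 / 2 * exp \<bar>x\<bar>" for x :: real
proof -
  obtain t where t: "\<bar>t\<bar> \<le> \<bar>x\<bar>" "exp x = (\<Sum>m<2. x ^ m / fact m) + exp t / fact 2 * x ^ 2"
    using Maclaurin_exp_le by blast
  have "exp t / fact 2 * x ^ 2 \<le> x\<^sup>2 / 2 * exp \<bar>x\<bar>"
    using t(1) by (simp add: mult.commute[of _ "x\<^sup>2"] mult_left_mono)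
  with t(2) show ?thesis
    by (simp add: numeral_2_eq_2)
qed

locale iid_sample = prob_space +
  fixes X :: "nat \<Rightarrow> 'a \<Rightarrow> 'b" and p :: "'b pmf"
  assumes indep: "indep_vars (\<lambda>_. count_space UNIV) X {1..}"
    and distr: "\<And>i. i \<ge> 1 \<Longrightarrow> distr M (count_space UNIV) (X i) = measure_pmf p"
begin

lemma random_variable_X: "i \<ge> 1 \<Longrightarrow> X i \<in> measurable M (count_space UNIV)"
  using indep by (auto simp: indep_vars_def)

lemma measurable_comp_X: "i \<ge> 1 \<Longrightarrow> (\<lambda>\<omega>. g (X i \<omega>)) \<in> borel_measurable M"
  by (rule measurable_compose[OF random_variable_X]) auto

lemma measurable_sum_X [measurable]:
  fixes g :: "'b \<Rightarrow> real"
  shows "(\<lambda>\<omega>. \<Sum>i=1..n. g (X i \<omega>)) \<in> borel_measurable M"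
  by (intro borel_measurable_sum measurable_comp_X) simp

lemma expectation_comp_X:
  fixes g :: "'b \<Rightarrow> real"
  assumes "i \<ge> 1"
  shows "expectation (\<lambda>\<omega>. g (X i \<omega>)) = measure_pmf.expectation p g"
  using integral_distr[OF random_variable_X[OF assms], of g] by (simp add: distr[OF assms])

lemma indep_comp_X: "indep_vars (\<lambda>_. borel) (\<lambda>i \<omega>. g (X i \<omega>)) {1..n}"
  by (rule indep_vars_compose2[OF indep_vars_subset[OF indep]]) auto

lemma AE_X_in_set_pmf: "i \<ge> 1 \<Longrightarrow> AE \<omega> in M. X i \<omega> \<in> set_pmf p"
  by (rule AE_distrD[OF random_variable_X]) (simp_all only: distr AE_measure_pmf)

text \<open>The failure event is null for each \<open>n\<close>, which suits any rate
  \<open>r\<close>.\<close>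

lemma whp_in_set_pmf: "whp r (\<lambda>n \<omega>. \<forall>i\<in>{1..n}. X i \<omega> \<in> set_pmf p)"
proof (rule whpI)
  fix n
  show ev: "{\<omega> \<in> space M. \<not> (\<forall>i\<in>{1..n}. X i \<omega> \<in> set_pmf p)} \<in> events" for n
  proof -
    have "{\<omega> \<in> space M. \<not> (\<forall>i\<in>{1..n}. X i \<omega> \<in> set_pmf p)}
        = (\<Union>i\<in>{1..n}. X i -` (- set_pmf p) \<inter> space M)"
      by auto
    also have "\<dots> \<in> events"
      by (intro sets.finite_UN measurable_sets[OF random_variable_X]) auto
    finally show ?thesis .
  qed
  have "prob {\<omega> \<in> space M. \<not> (\<forall>i\<in>{1..n}. X i \<omega> \<in> set_pmf p)} = 0" for n
  proof -
    have "AE \<omega> in M. \<forall>i\<in>{1..n}. X i \<omega> \<in> set_pmf p"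
      by (intro AE_finite_allI AE_X_in_set_pmf) auto
    then have "AE \<omega> in M. \<omega> \<notin> {\<omega> \<in> space M. \<not> (\<forall>i\<in>{1..n}. X i \<omega> \<in> set_pmf p)}"
      by eventually_elim auto
    then show ?thesis
      using prob_eq_0[OF ev] by simp
  qed
  then show "(\<lambda>n. prob {\<omega> \<in> space M. \<not> (\<forall>i\<in>{1..n}. X i \<omega> \<in> set_pmf p)}) \<in> O(r)"
    by simp
qed

text \<open>Hoeffding's inequality bounds the failure probability exponentially in \<open>n\<close>,
  far below the rate claimed.\<close>

lemma whp_mean_close:
  fixes g :: "'b \<Rightarrow> real"
  assumes bounded: "\<And>x. \<bar>g x\<bar> \<le> B" and "\<delta> > 0"
  shows "whp (\<lambda>n. 1 / sqrt (real n))
           (\<lambda>n \<omega>. \<bar>(\<Sum>i=1..n. g (X i \<omega>)) / real n - measure_pmf.expectation p g\<bar> < \<delta>)"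
proof (rule whpI)
  let ?\<mu> = "measure_pmf.expectation p g"
  let ?A = "\<lambda>n. {\<omega> \<in> space M. \<not> \<bar>(\<Sum>i=1..n. g (X i \<omega>)) / real n - ?\<mu>\<bar> < \<delta>}"
  show "?A n \<in> events" for n
    by measurable
  have "B \<ge> 0"
    using bounded[of undefined] by simp
  have bound: "prob (?A n) \<le> 2 * exp (- (\<delta>\<^sup>2 / (2 * (B + 1)\<^sup>2)) * real n)" if "n \<ge> 1" for n
  proof -
    \<comment> \<open>The range is widened from \<open>B\<close> to \<open>B + 1\<close> so that the
      sum of squared widths is positive even for \<open>B = 0\<close>.\<close>
    interpret Hoeffding_ineq M "{1..n}" "\<lambda>i \<omega>. g (X i \<omega>)" "\<lambda>_. - (B + 1)" "\<lambda>_. B + 1"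
      "\<Sum>i=1..n. expectation (\<lambda>\<omega>. g (X i \<omega>))"
    proof unfold_locales
      show "AE \<omega> in M. g (X i \<omega>) \<in> {- (B + 1)..B + 1}" for i
        using bounded by (intro AE_I2) (simp add: abs_le_iff, smt (verit))
    qed (use indep_comp_X in auto)
    have mean: "(\<Sum>i=1..n. expectation (\<lambda>\<omega>. g (X i \<omega>))) = real n * ?\<mu>"
      by (simp add: expectation_comp_X)
    have range: "(\<Sum>i=1..n. (B + 1 - - (B + 1))\<^sup>2) = real n * (2 * (B + 1))\<^sup>2"
      by simp
    have "?A n = {\<omega> \<in> space M. \<bar>(\<Sum>i=1..n. g (X i \<omega>)) - real n * ?\<mu>\<bar> \<ge> real n * \<delta>}"
    proof -
      have "\<bar>s / real n - ?\<mu>\<bar> = \<bar>s - real n * ?\<mu>\<bar> / real n" for s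
        using that by (simp add: field_simps abs_div_pos flip: abs_divide)
      then show ?thesis
        using that by (auto simp: field_simps not_less)
    qed
    then have "prob (?A n) \<le> 2 * exp (- 2 * (real n * \<delta>)\<^sup>2 / (real n * (2 * (B + 1))\<^sup>2))"
      using Hoeffding_ineq_abs_ge[of "real n * \<delta>"] that \<open>\<delta> > 0\<close> \<open>B \<ge> 0\<close>
      unfolding mean range by simp
    also have "- 2 * (real n * \<delta>)\<^sup>2 / (real n * (2 * (B + 1))\<^sup>2)
        = - (\<delta>\<^sup>2 / (2 * (B + 1)\<^sup>2)) * real n"
      unfolding power_mult_distrib using that by (simp add: power2_eq_square[of "real n"])
    finally show ?thesis .
  qed
  define c where "c = \<delta>\<^sup>2 / (2 * (B + 1)\<^sup>2)"
  have "c > 0"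
    using \<open>\<delta> > 0\<close> \<open>B \<ge> 0\<close> by (simp add: c_def)
  have "(\<lambda>n. prob (?A n)) \<in> O(\<lambda>n. 2 * exp (- c * real n))"
    by (rule bigoI[of _ 1], use eventually_ge_at_top[of 1] in eventually_elim)
      (use bound in \<open>simp add: c_def\<close>)
  also have "(\<lambda>n. 2 * exp (- c * real n)) \<in> O(\<lambda>n. 1 / sqrt (real n))"
    using \<open>c > 0\<close> by real_asymp
  finally show "(\<lambda>n. prob (?A n)) \<in> O(\<lambda>n. 1 / sqrt (real n))" .
qed

text \<open>Chernoff's method: Markov's inequality for the exponential of \<open>l\<close> times the
  sum. Centring removes the linear term of the moment generating function, and the quadratic term
  carries the true variance, up to the factor \<open>exp (l * B)\<close>.\<close>

lemma prob_sum_ge_le: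
  fixes g :: "'b \<Rightarrow> real"
  assumes bounded: "\<And>x. \<bar>g x\<bar> \<le> B" and centred: "measure_pmf.expectation p g = 0" and "l > 0"
  shows "prob {\<omega> \<in> space M. (\<Sum>i=1..n. g (X i \<omega>)) \<ge> s}
    \<le> exp (real n * (l\<^sup>2 * measure_pmf.expectation p (\<lambda>x. (g x)\<^sup>2) * exp (l * B) / 2) - l * s)"
proof -
  let ?v = "measure_pmf.expectation p (\<lambda>x. (g x)\<^sup>2)"
  have "B \<ge> 0"
    using bounded[of undefined] by simp
  have int_g: "integrable (measure_pmf p) g"
    by (rule measure_pmf.integrable_const_bound[of _ B]) (use bounded in auto)
  have int_g2: "integrable (measure_pmf p) (\<lambda>x. (g x)\<^sup>2)"
    by (rule measure_pmf.integrable_const_bound[of _ "B\<^sup>2"])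
      (use bounded in \<open>auto simp: abs_le_square_iff[symmetric] \<open>B \<ge> 0\<close>\<close>)
  have exp_bounded: "exp (l * g x) \<le> exp (l * B)" for x
    using bounded[of x] \<open>l > 0\<close> by (simp add: abs_le_iff)
  have int_exp: "integrable (measure_pmf p) (\<lambda>x. exp (l * g x))"
    by (rule measure_pmf.integrable_const_bound[of _ "exp (l * B)"]) (use exp_bounded in auto)
  have "measure_pmf.expectation p (\<lambda>x. exp (l * g x))
      \<le> measure_pmf.expectation p (\<lambda>x. 1 + l * g x + l\<^sup>2 * exp (l * B) / 2 * (g x)\<^sup>2)"
  proof (rule integral_mono)
    fix x
    have "\<bar>l * g x\<bar> \<le> l * B"
      using bounded[of x] \<open>l > 0\<close> by (simp add: abs_mult)
    then have "(l * g x)\<^sup>2 / 2 * exp \<bar>l * g x\<bar> \<le> (l * g x)\<^sup>2 / 2 * exp (l * B)"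
      by (intro mult_left_mono) auto
    then show "exp (l * g x) \<le> 1 + l * g x + l\<^sup>2 * exp (l * B) / 2 * (g x)\<^sup>2"
      using exp_le_quadratic[of "l * g x"] by (simp add: power_mult_distrib mult_ac)
  qed (use int_exp int_g int_g2 in auto)
  also have "\<dots> = 1 + l\<^sup>2 * ?v * exp (l * B) / 2"
    using int_g int_g2 centred by (simp add: mult_ac)
  also have "\<dots> \<le> exp (l\<^sup>2 * ?v * exp (l * B) / 2)"
    by (rule exp_ge_add_one_self)
  finally have mgf: "measure_pmf.expectation p (\<lambda>x. exp (l * g x)) \<le> exp (l\<^sup>2 * ?v * exp (l * B) / 2)" .
  let ?S = "\<lambda>\<omega>. \<Sum>i=1..n. g (X i \<omega>)"
  have prod_eq: "exp (l * ?S \<omega>) = (\<Prod>i=1..n. exp (l * g (X i \<omega>)))" for \<omega>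
    by (simp add: sum_distrib_left exp_sum)
  have integrable_exp: "integrable M (\<lambda>\<omega>. exp (l * g (X i \<omega>)))" if "i \<in> {1..n}" for i
    by (rule integrable_const_bound[of _ "exp (l * B)"]) (use exp_bounded that measurable_comp_X[of i "\<lambda>x. exp (l * g x)"] in auto)
  have indep_exp: "indep_vars (\<lambda>_. borel) (\<lambda>i \<omega>. exp (l * g (X i \<omega>))) {1..n}"
    using indep_comp_X[of "\<lambda>x. exp (l * g x)" n] .
  \<comment> \<open>Independence factors the moment generating function of the sum.\<close>
  have "expectation (\<lambda>\<omega>. exp (l * ?S \<omega>)) = (\<Prod>i=1..n. expectation (\<lambda>\<omega>. exp (l * g (X i \<omega>))))"
    unfolding prod_eq by (rule indep_vars_lebesgue_integral) (use integrable_exp indep_exp in auto)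
  also have "\<dots> = measure_pmf.expectation p (\<lambda>x. exp (l * g x)) ^ n"
    by (simp add: expectation_comp_X[of _ "\<lambda>x. exp (l * g x)"])
  also have "\<dots> \<le> exp (l\<^sup>2 * ?v * exp (l * B) / 2) ^ n"
    using mgf by (intro power_mono) auto
  also have "\<dots> = exp (real n * (l\<^sup>2 * ?v * exp (l * B) / 2))"
    by (rule exp_of_nat_mult[symmetric])
  finally have mgf_sum: "expectation (\<lambda>\<omega>. exp (l * ?S \<omega>)) \<le> exp (real n * (l\<^sup>2 * ?v * exp (l * B) / 2))" .
  have integrable_sum: "integrable M (\<lambda>\<omega>. exp (l * ?S \<omega>))"
    unfolding prod_eq by (rule indep_vars_integrable) (use integrable_exp indep_exp in auto)
  have "prob {\<omega> \<in> space M. ?S \<omega> \<ge> s} = prob {\<omega> \<in> space M. exp (l * ?S \<omega>) \<ge> exp (l * s)}"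
    using \<open>l > 0\<close> by simp
  also have "\<dots> \<le> expectation (\<lambda>\<omega>. exp (l * ?S \<omega>)) / exp (l * s)"
    by (rule integral_Markov_inequality_measure[OF integrable_sum, where A = "{}"]) auto
  also have "\<dots> \<le> exp (real n * (l\<^sup>2 * ?v * exp (l * B) / 2)) / exp (l * s)"
    by (intro divide_right_mono mgf_sum) auto
  finally show ?thesis
    by (simp add: exp_diff)
qed

lemma whp_sum_less:
  fixes g :: "'b \<Rightarrow> real"
  assumes bounded: "\<And>x. \<bar>g x\<bar> \<le> B" and centred: "measure_pmf.expectation p g = 0"
    and variance: "measure_pmf.expectation p (\<lambda>x. (g x)\<^sup>2) = \<sigma>\<^sup>2" and "\<sigma> > 0"
  shows "whp (\<lambda>n. 1 / sqrt (real n))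
    (\<lambda>n \<omega>. (\<Sum>i=1..n. g (X i \<omega>)) < sqrt (real n) * (sqrt (4 / 3 * ln (real n)) * (15 / 16 * \<sigma>)))"
proof (rule whpI)
  let ?s = "\<lambda>n. sqrt (real n) * (sqrt (4 / 3 * ln (real n)) * (15 / 16 * \<sigma>))"
  let ?A = "\<lambda>n. {\<omega> \<in> space M. \<not> (\<Sum>i=1..n. g (X i \<omega>)) < ?s n}"
  show "?A n \<in> events" for n
    by measurable
  \<comment> \<open>With t = \<open>sqrt (4/3 * ln n)\<close>, this choice gives n l^2 \<sigma>^2 =
    t^2 and turns \<open>l * ?s n\<close> into 15/16 t^2.\<close>
  define l where "l n = sqrt (4 / 3 * ln (real n)) / (\<sigma> * sqrt (real n))" for n
  have "((\<lambda>n. exp (l n * B)) \<longlongrightarrow> exp (0 * B)) sequentially"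
    unfolding l_def using \<open>\<sigma> > 0\<close> by (intro tendsto_intros) real_asymp
  \<comment> \<open>Since \<open>l\<close> tends to 0, the correction factor of the Chernoff bound
    tends to 1.\<close>
  then have "\<forall>\<^sub>F n in sequentially. exp (l n * B) < 9 / 8"
    by (rule order_tendstoD) simp
  with eventually_gt_at_top[of 1] have "\<forall>\<^sub>F n in sequentially. prob (?A n) \<le> 1 / sqrt (real n)"
  proof eventually_elim
    case (elim n)
    define t where "t = sqrt (4 / 3 * ln (real n))"
    have t2: "t\<^sup>2 = 4 / 3 * ln (real n)" and "t > 0"
      using elim by (auto simp: t_def)
    have "l n > 0"
      using elim \<open>\<sigma> > 0\<close> by (simp add: l_def)
    have l2: "real n * ((l n)\<^sup>2 * \<sigma>\<^sup>2) = t\<^sup>2"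
      using elim \<open>\<sigma> > 0\<close> unfolding l_def t_def[symmetric] by (simp add: power_divide power_mult_distrib)
    have ls: "l n * ?s n = 15 / 16 * t\<^sup>2"
      using elim \<open>\<sigma> > 0\<close> unfolding l_def t_def[symmetric] by (simp add: power2_eq_square)
    have "prob (?A n) \<le> exp (real n * ((l n)\<^sup>2 * \<sigma>\<^sup>2 * exp (l n * B) / 2) - l n * ?s n)"
      using prob_sum_ge_le[OF bounded centred \<open>l n > 0\<close>, where n = n and s = "?s n"]
      unfolding variance by (simp add: not_less)
    also have "real n * ((l n)\<^sup>2 * \<sigma>\<^sup>2 * exp (l n * B) / 2) - l n * ?s n
        = t\<^sup>2 * exp (l n * B) / 2 - 15 / 16 * t\<^sup>2"
      unfolding ls l2[symmetric] by simp
    also have "\<dots> \<le> t\<^sup>2 * (9 / 8) / 2 - 15 / 16 * t\<^sup>2"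
      using elim by (intro diff_right_mono divide_right_mono mult_left_mono) auto
    \<comment> \<open>The coefficient is 9/16 - 15/16 = -3/8, and 3/8 * 4/3 = 1/2.\<close>
    also have "\<dots> = - ln (sqrt (real n))"
      using elim by (simp add: t2 ln_sqrt)
    also have "exp \<dots> = 1 / sqrt (real n)"
      using elim by (simp add: exp_minus inverse_eq_divide)
    finally show ?case
      by simp
  qed
  then show "(\<lambda>n. prob (?A n)) \<in> O(\<lambda>n. 1 / sqrt (real n))"
    by (intro bigoI[of _ 1]) simp
qed

end

section \<open>The tests\<close>

lemma var_hat_eq:
  "var_hat k n x j = (\<Sum>i=1..n. (nabla k (\<lambda>l. of_bool (x i = l)) j)\<^sup>2) / real n
     - ((\<Sum>i=1..n. nabla k (\<lambda>l. of_bool (x i = l)) j) / real n)\<^sup>2"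
  by (simp add: var_hat_def nabla_p_hat)

text \<open>Cauchy-Schwarz. The sign matters because \<open>sqrt\<close> is negative at negative
  arguments, while the test is to be multiplied through by \<open>sigma_hat\<close>.\<close>

lemma var_hat_nonneg: "var_hat k n x j \<ge> 0"
proof (cases "n = 0")
  case False
  let ?g = "\<lambda>i. nabla k (\<lambda>l. of_bool (x i = l)) j"
  have "(\<Sum>i=1..n. ?g i)\<^sup>2 \<le> real n * (\<Sum>i=1..n. (?g i)\<^sup>2)"
    using sum_squared_le_sum_of_squares[of ?g "{1..n}"] by (simp add: mult.commute)
  then have "(\<Sum>i=1..n. ?g i)\<^sup>2 / (real n)\<^sup>2 \<le> real n * (\<Sum>i=1..n. (?g i)\<^sup>2) / (real n)\<^sup>2"
    by (rule divide_right_mono) simp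
  also have "\<dots> = (\<Sum>i=1..n. (?g i)\<^sup>2) / real n"
    by (simp add: power2_eq_square)
  finally show ?thesis
    unfolding var_hat_eq power_divide by simp
qed (simp add: var_hat_def nabla_p_hat)

lemma sigma_hat_nonneg: "sigma_hat k n x j \<ge> 0"
  by (simp add: sigma_hat_def var_hat_nonneg)

text \<open>Since \<open>sigma_hat\<close> is nonnegative, multiplying by it merges the regular test
  and the reading for zero variance into one inequality.\<close>

lemma I0_hat_eq:
  "I0_hat k n x = {j \<in> S_hat k n x. sqrt (real n) * nabla k (p_hat n x) j
     \<le> std_normal_quantile (1 - 1 / real n) * sigma_hat k n x j}"
proof -
  have "(if s = 0 then a \<le> q * s else a / s \<le> q) \<longleftrightarrow> a \<le> q * s" if "s \<ge> 0" for s a q :: real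
    using that by (cases "s = 0") (simp_all add: pos_divide_le_eq)
  then show ?thesis
    unfolding I0_hat_def by (simp only: sigma_hat_nonneg)
qed

text \<open>The empirical variance is at most the empirical second moment of variables bounded by
  \<open>2 ^ k\<close>. This caps the critical value when \<nabla>p(j) > 0.\<close>

lemma sigma_hat_le: "sigma_hat k n x j \<le> 2 ^ k"
proof (cases "n = 0")
  case False
  have "(\<Sum>i=1..n. (nabla k (\<lambda>l. of_bool (x i = l)) j)\<^sup>2) \<le> (\<Sum>i=1..n. (2 ^ k)\<^sup>2)"
    by (intro sum_mono) (metis abs_nabla_of_bool_le abs_ge_zero power2_abs power_mono)
  then have "(\<Sum>i=1..n. (nabla k (\<lambda>l. of_bool (x i = l)) j)\<^sup>2) / real n \<le> (2 ^ k)\<^sup>2"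
    using False by (simp add: field_simps)
  then have "var_hat k n x j \<le> (2 ^ k)\<^sup>2"
    unfolding var_hat_eq by (smt (verit) zero_le_power2)
  then show ?thesis
    unfolding sigma_hat_def by (rule real_le_lsqrt[rotated]) simp
qed (simp add: sigma_hat_def var_hat_def nabla_p_hat)

text \<open>A positive empirical frequency means that the point is observed. Recovery of the support
  is thereby reduced to two sample means.\<close>

lemma S_hat_eq:
  assumes "\<forall>i\<in>{1..n}. x i \<in> {m..M}" and "p_hat n x m > 0" and "p_hat n x M > 0"
  shows "S_hat k n x = S_k k m M"
proof -
  have attained: "l \<in> x ` {1..n}" if "p_hat n x l > 0" for l
  proof (rule ccontr)
    assume "l \<notin> x ` {1..n}"
    then have "p_hat n x l = 0"
      by (auto simp: p_hat_def intro!: sum.neutral)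
    with that show False
      by simp
  qed
  have "Min (x ` {1..n}) = m" "Max (x ` {1..n}) = M"
    using assms(1) attained[OF assms(2)] attained[OF assms(3)] by (auto intro!: Min_eqI Max_eqI)
  then show ?thesis
    by (simp add: S_hat_def S_k_def)
qed

section \<open>From the individual tests to the estimated set\<close>

theorem theorem2:
  fixes k :: nat and m M :: int and p :: "int pmf"
    and P :: "'a measure" and X :: "nat \<Rightarrow> 'a \<Rightarrow> int"
  assumes "k \<ge> 1" and "m \<le> M - int k"
    and "set_pmf p = {m..M}"
    and "prob_space P"
    and "prob_space.indep_vars P (\<lambda>_. count_space UNIV) X {1..}"
    and "\<And>i. i \<ge> 1 \<Longrightarrow> distr P (count_space UNIV) (X i) = measure_pmf p"
  shows "(rho k m M p = 0 \<longrightarrow>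
            (\<lambda>n. measure P {\<omega> \<in> space P. I0_hat k n (\<lambda>i. X i \<omega>) \<noteq> I_level k m M p 0})
              \<in> O(\<lambda>n. 1 / sqrt (real n)))
       \<and> (rho k m M p > 0 \<longrightarrow>
            (\<lambda>n. measure P {\<omega> \<in> space P. I0_hat k n (\<lambda>i. X i \<omega>) \<noteq> {}})
              \<in> O(\<lambda>n. 1 / sqrt (real n)))
       \<and> (rho k m M p < 0 \<longrightarrow>
            (\<lambda>n. measure P {\<omega> \<in> space P. I0_hat k n (\<lambda>i. X i \<omega>)
                                \<noteq> I_neg k m M p \<union> I_level k m M p 0})
              \<in> O(\<lambda>n. 1 / sqrt (real n)))"
proof -
  interpret prob_space P
    by fact
  interpret iid_sample P X p
    by unfold_locales fact+
  let ?r = "\<lambda>n. 1 / sqrt (real n)"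
  let ?q = "\<lambda>n. std_normal_quantile (1 - 1 / real n)"
  let ?x = "\<lambda>\<omega> i. X i \<omega>"
  let ?pass = "\<lambda>j n \<omega>. sqrt (real n) * nabla k (p_hat n (?x \<omega>)) j \<le> ?q n * sigma_hat k n (?x \<omega>) j"
  define g where "g j x = nabla k (\<lambda>l. of_bool (x = l)) j" for j x :: int
  have fin: "finite (set_pmf p)"
    by (simp add: assms(3))
  have g_le: "\<bar>g j x\<bar> \<le> 2 ^ k" for j x
    unfolding g_def by (rule abs_nabla_of_bool_le)
  have nabla_p: "nabla k (pmf p) j = measure_pmf.expectation p (g j)" for j
    unfolding g_def by (rule nabla_pmf[OF fin])
  have nabla_hat: "nabla k (p_hat n (?x \<omega>)) j = (\<Sum>i=1..n. g j (X i \<omega>)) / real n" for n \<omega> j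
    unfolding g_def by (rule nabla_p_hat)
  have close: "whp ?r (\<lambda>n \<omega>. \<bar>nabla k (p_hat n (?x \<omega>)) j - nabla k (pmf p) j\<bar> < \<delta>)" if "\<delta> > 0" for j \<delta>
    unfolding nabla_hat nabla_p by (rule whp_mean_close[OF g_le that])
  have attained: "whp ?r (\<lambda>n \<omega>. p_hat n (?x \<omega>) l > 0)" if "l \<in> {m..M}" for l
  proof -
    have "pmf p l > 0"
      using that assms(3) by (simp add: pmf_positive_iff)
    \<comment> \<open>A deviation smaller than \<open>pmf p l\<close> leaves the empirical frequency
      of \<open>l\<close> positive.\<close>
    have "whp ?r (\<lambda>n \<omega>. \<bar>(\<Sum>i=1..n. of_bool (X i \<omega> = l)) / real n
        - measure_pmf.expectation p (\<lambda>x. of_bool (x = l))\<bar> < pmf p l)"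
      using \<open>pmf p l > 0\<close> by (intro whp_mean_close[where B = 1]) auto
    moreover have "measure_pmf.expectation p (\<lambda>x. of_bool (x = l)) = pmf p l"
      using fdiff_pmf[OF fin, of 0 l] by simp
    ultimately show ?thesis
      by (elim whp_mono) (auto simp: p_hat_def intro!: always_eventually)
  qed
  have "whp ?r (\<lambda>n \<omega>. p_hat n (?x \<omega>) m > 0 \<and> p_hat n (?x \<omega>) M > 0)"
    using assms(2) by (intro whp_conj attained) auto
  from whp_conj[OF whp_in_set_pmf this] have support: "whp ?r (\<lambda>n \<omega>. S_hat k n (?x \<omega>) = S_k k m M)"
    unfolding assms(3) by (rule whp_mono) (intro always_eventually allI ballI impI, elim conjE, rule S_hat_eq)
  have test: "whp ?r (\<lambda>n \<omega>. ?pass j n \<omega> \<longleftrightarrow> nabla k (pmf p) j \<le> 0)" if j: "j \<in> S_k k m M" for j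
  proof (cases "nabla k (pmf p) j" "0::real" rule: linorder_cases)
    case less
    \<comment> \<open>A deviation smaller than the modulus of the mean keeps the estimate negative,
      whereas the critical value is eventually nonnegative.\<close>
    then have "whp ?r (\<lambda>n \<omega>. \<bar>nabla k (p_hat n (?x \<omega>)) j - nabla k (pmf p) j\<bar> < - nabla k (pmf p) j)"
      by (intro close) simp
    then show ?thesis
    proof (rule whp_mono)
      show "\<forall>\<^sub>F n in sequentially. \<forall>\<omega>\<in>space P.
          \<bar>nabla k (p_hat n (?x \<omega>)) j - nabla k (pmf p) j\<bar> < - nabla k (pmf p) j
          \<longrightarrow> (?pass j n \<omega> \<longleftrightarrow> nabla k (pmf p) j \<le> 0)"
        using eventually_std_normal_quantile_bounds eventually_gt_at_top[of 0]
      proof (eventually_elim, intro ballI impI)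
        fix n \<omega>
        assume q: "sqrt (4 / 3 * ln (real n)) \<le> ?q n \<and> ?q n \<le> 2 * real n powr (1 / 4)" and "0 < n"
          and "\<bar>nabla k (p_hat n (?x \<omega>)) j - nabla k (pmf p) j\<bar> < - nabla k (pmf p) j"
        then have "sqrt (real n) * nabla k (p_hat n (?x \<omega>)) j \<le> 0"
          by (intro mult_nonneg_nonpos) auto
        also have "0 \<le> ?q n * sigma_hat k n (?x \<omega>) j"
          using order_trans[OF _ conjunct1[OF q]] \<open>0 < n\<close>
          by (intro mult_nonneg_nonneg sigma_hat_nonneg) simp
        finally show "?pass j n \<omega> \<longleftrightarrow> nabla k (pmf p) j \<le> 0"
          using less by simp
      qed
    qed
  next
    case greater
    \<comment> \<open>If the estimate stays above half its mean, the left side of the test is at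
      least \<open>sqrt n * c\<close>, which outgrows the critical value of order
      \<open>n powr (1/4)\<close>.\<close>
    define c where "c = nabla k (pmf p) j / 2"
    have "c > 0"
      using greater by (simp add: c_def)
    have growth: "\<forall>\<^sub>F n::nat in sequentially. 2 * real n powr (1 / 4) * 2 ^ k < sqrt (real n) * c"
      using \<open>c > 0\<close> by real_asymp
    show ?thesis
    proof (rule whp_mono[OF close[OF \<open>c > 0\<close>, of j]])
      show "\<forall>\<^sub>F n in sequentially. \<forall>\<omega>\<in>space P.
          \<bar>nabla k (p_hat n (?x \<omega>)) j - nabla k (pmf p) j\<bar> < c
          \<longrightarrow> (?pass j n \<omega> \<longleftrightarrow> nabla k (pmf p) j \<le> 0)"
        using eventually_std_normal_quantile_bounds growth
      proof (eventually_elim, intro ballI impI)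
        fix n \<omega>
        assume q: "sqrt (4 / 3 * ln (real n)) \<le> ?q n \<and> ?q n \<le> 2 * real n powr (1 / 4)"
          and n: "2 * real n powr (1 / 4) * 2 ^ k < sqrt (real n) * c"
          and \<omega>: "\<bar>nabla k (p_hat n (?x \<omega>)) j - nabla k (pmf p) j\<bar> < c"
        have "?q n * sigma_hat k n (?x \<omega>) j \<le> 2 * real n powr (1 / 4) * 2 ^ k"
          using q by (intro mult_mono sigma_hat_le sigma_hat_nonneg) auto
        also note n
        also have "sqrt (real n) * c \<le> sqrt (real n) * nabla k (p_hat n (?x \<omega>)) j"
          using \<omega> unfolding c_def by (intro mult_left_mono) (auto simp: abs_if split: if_splits)
        finally show "?pass j n \<omega> \<longleftrightarrow> nabla k (pmf p) j \<le> 0"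
          using greater by simp
      qed
    qed
  next
    case equal
    define v where "v = measure_pmf.expectation p (\<lambda>x. (g j x)\<^sup>2)"
    define \<sigma> where "\<sigma> = sqrt v"
    \<comment> \<open>The point \<open>j + k\<close> is an atom of \<open>p\<close> because
      \<open>j\<close> lies in \<open>S_k\<close>, and \<open>g j\<close> takes the value 1 or -1
      there.\<close>
    have "v > 0"
    proof -
      have top: "j + int k \<in> set_pmf p"
        using j by (auto simp: assms(3) S_k_def)
      have "g j (j + int k) \<noteq> 0"
        by (simp add: g_def nabla_def fdiff_of_bool_top)
      then have "0 < pmf p (j + int k) * (g j (j + int k))\<^sup>2"
        using top by (simp add: pmf_positive_iff)
      also have "\<dots> \<le> (\<Sum>x\<in>set_pmf p. pmf p x * (g j x)\<^sup>2)"
        by (rule member_le_sum[OF top]) (auto simp: fin)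
      also have "\<dots> = v"
        unfolding v_def by (subst integral_measure_pmf_real[OF fin]) (auto simp: mult.commute)
      finally show ?thesis .
    qed
    then have "\<sigma> > 0" and \<sigma>2: "v = \<sigma>\<^sup>2"
      by (auto simp: \<sigma>_def)
    \<comment> \<open>The tolerances here and in \<open>mean\<close> make the empirical variance at
      least (1 - 1/20 - 1/25) \<sigma>^2 = 0.91 \<sigma>^2. This exceeds (15/16)^2 \<sigma>^2, so
      \<open>sigma_hat\<close> is at least 15/16 \<sigma>.\<close>
    have sq: "whp ?r (\<lambda>n \<omega>. \<bar>(\<Sum>i=1..n. (g j (X i \<omega>))\<^sup>2) / real n - v\<bar> < \<sigma>\<^sup>2 / 20)"
      unfolding v_def
    proof (rule whp_mean_close)
      show "\<bar>(g j x)\<^sup>2\<bar> \<le> (2 ^ k)\<^sup>2" for x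
        using g_le[of j x] by (simp add: abs_le_square_iff[symmetric])
    qed (use \<open>\<sigma> > 0\<close> in simp)
    have mean: "whp ?r (\<lambda>n \<omega>. \<bar>nabla k (p_hat n (?x \<omega>)) j\<bar> < \<sigma> / 5)"
      using close[of "\<sigma> / 5" j] \<open>\<sigma> > 0\<close> by (simp add: equal)
    \<comment> \<open>The threshold uses the deterministic lower bound 15/16 \<sigma> in place of
      the random \<open>sigma_hat\<close>, so numerator and denominator are controlled
      separately.\<close>
    have "whp ?r (\<lambda>n \<omega>. (\<Sum>i=1..n. g j (X i \<omega>))
        < sqrt (real n) * (sqrt (4 / 3 * ln (real n)) * (15 / 16 * \<sigma>)))"
      using nabla_p[of j] equal \<sigma>2 \<open>\<sigma> > 0\<close> by (intro whp_sum_less[OF g_le]) (auto simp: v_def)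
    from whp_conj[OF whp_conj[OF sq mean] this] show ?thesis
    proof (rule whp_mono)
      show "\<forall>\<^sub>F n in sequentially. \<forall>\<omega>\<in>space P.
          (\<bar>(\<Sum>i=1..n. (g j (X i \<omega>))\<^sup>2) / real n - v\<bar> < \<sigma>\<^sup>2 / 20
            \<and> \<bar>nabla k (p_hat n (?x \<omega>)) j\<bar> < \<sigma> / 5)
          \<and> (\<Sum>i=1..n. g j (X i \<omega>)) < sqrt (real n) * (sqrt (4 / 3 * ln (real n)) * (15 / 16 * \<sigma>))
          \<longrightarrow> (?pass j n \<omega> \<longleftrightarrow> nabla k (pmf p) j \<le> 0)"
        using eventually_std_normal_quantile_bounds eventually_gt_at_top[of 0]
      proof (eventually_elim, intro ballI impI, elim conjE)
        fix n \<omega>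
        assume q: "sqrt (4 / 3 * ln (real n)) \<le> ?q n" and "0 < n"
          and sq: "\<bar>(\<Sum>i=1..n. (g j (X i \<omega>))\<^sup>2) / real n - v\<bar> < \<sigma>\<^sup>2 / 20"
          and mean: "\<bar>nabla k (p_hat n (?x \<omega>)) j\<bar> < \<sigma> / 5"
          and sum: "(\<Sum>i=1..n. g j (X i \<omega>)) < sqrt (real n) * (sqrt (4 / 3 * ln (real n)) * (15 / 16 * \<sigma>))"
        have "(nabla k (p_hat n (?x \<omega>)) j)\<^sup>2 \<le> (\<sigma> / 5)\<^sup>2"
          using mean \<open>\<sigma> > 0\<close> by (simp flip: abs_le_square_iff)
        then have mean2: "(nabla k (p_hat n (?x \<omega>)) j)\<^sup>2 \<le> \<sigma>\<^sup>2 / 25"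
          by (simp add: power_divide)
        have "var_hat k n (?x \<omega>) j = (\<Sum>i=1..n. (g j (X i \<omega>))\<^sup>2) / real n - (nabla k (p_hat n (?x \<omega>)) j)\<^sup>2"
          by (simp add: var_hat_def g_def)
        moreover have "(15 / 16 * \<sigma>)\<^sup>2 = 225 / 256 * \<sigma>\<^sup>2"
          by (simp add: power_mult_distrib power_divide)
        ultimately have "(15 / 16 * \<sigma>)\<^sup>2 \<le> var_hat k n (?x \<omega>) j"
          using sq mean2 \<sigma>2 zero_le_power2[of \<sigma>] by linarith
        then have sigma: "15 / 16 * \<sigma> \<le> sigma_hat k n (?x \<omega>) j"
          unfolding sigma_hat_def by (rule real_le_rsqrt)
        have "sqrt (real n) * nabla k (p_hat n (?x \<omega>)) j = (\<Sum>i=1..n. g j (X i \<omega>)) / sqrt (real n)"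
          using \<open>0 < n\<close> by (simp add: nabla_hat field_simps)
        also have "\<dots> \<le> sqrt (4 / 3 * ln (real n)) * (15 / 16 * \<sigma>)"
          using sum \<open>0 < n\<close> by (simp add: field_simps)
        also have "\<dots> \<le> ?q n * sigma_hat k n (?x \<omega>) j"
          using q sigma \<open>0 < n\<close> \<open>\<sigma> > 0\<close>
          by (intro mult_mono order_trans[OF _ q]) auto
        finally show "?pass j n \<omega> \<longleftrightarrow> nabla k (pmf p) j \<le> 0"
          using equal by simp
      qed
    qed
  qed
  have "whp ?r (\<lambda>n \<omega>. \<forall>j\<in>S_k k m M. ?pass j n \<omega> \<longleftrightarrow> nabla k (pmf p) j \<le> 0)"
    by (rule whp_ball[OF _ test]) (simp_all add: S_k_def)
  from whp_conj[OF support this]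
  have "whp ?r (\<lambda>n \<omega>. I0_hat k n (?x \<omega>) = {j \<in> S_k k m M. nabla k (pmf p) j \<le> 0})"
    by (rule whp_mono) (auto simp: I0_hat_eq intro!: always_eventually)
  from prob_not_bigo_if_whp[OF this]
  have main: "(\<lambda>n. prob {\<omega> \<in> space P. I0_hat k n (?x \<omega>) \<noteq> {j \<in> S_k k m M. nabla k (pmf p) j \<le> 0}}) \<in> O(?r)" .
  \<comment> \<open>As \<open>rho\<close> is the minimum, no value is negative if \<open>rho\<close>
    is 0 and none is nonpositive if it is positive; the lower end of the interval in
    \<open>H_neg\<close> excludes no attained value.\<close>
  have rho_le: "rho k m M p \<le> nabla k (pmf p) j" if "j \<in> S_k k m M" for j
    using that by (simp add: rho_def S_k_def)
  have "{j \<in> S_k k m M. nabla k (pmf p) j \<le> 0} = I_level k m M p 0" if "rho k m M p = 0"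
    using rho_le that by (force simp: I_level_def)
  moreover have "{j \<in> S_k k m M. nabla k (pmf p) j \<le> 0} = {}" if "rho k m M p > 0"
    using rho_le that by force
  moreover have "{j \<in> S_k k m M. nabla k (pmf p) j \<le> 0} = I_neg k m M p \<union> I_level k m M p 0"
    using rho_le by (auto simp: I_neg_def I_level_def H_neg_def)
  ultimately show ?thesis
    using main by auto
qed

end
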